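(* For any $\mathcal F$ (as in the context), if the PSOD or the MSOD is used, then for all $k\ne k'$, $$\mathrm{var}(D_{kk'})\le\frac{(\|f_k\|+\|f_{k'}\|)^2}{2}\Big(1-\frac1m\Big)\mathbb E[M_{\mathrm{opt}}^2],$$ where $M_{\mathrm{opt}}^2=M_{\mathrm{P\text{-}opt}}^2$ or $M_{\mathrm{opt}}^2=M_{\mathrm{M\text{-}opt}}^2$ respectively.
   Context: Setup. There are $m\ge2$ treatments and $n=mp$ subjects; the tuples $(X_i,Y_{i1},\dots,Y_{im})$, $i=1,\dots,n$, are i.i.d., where $X_i\in\mathcal X$ are baseline covariates and $Y_{ik}\in\mathbb R$ is the potential outcome of subject $i$ under treatment $k$, with finite second moment. $X=(X_1,\dots,X_n)$, $Y=(Y_{ik})$; $f_k(x)=\mathbb E[Y_{ik}\mid X_i=x]$. $W\in\{1,\dots,m\}^n$ is the random assignment, drawn according to the design given $X$, independently of $Y$ given $X$. $\mathcal W\subset\{1,\dots,m\}^n$ is the set of assignments with exactly $p$ subjects in each treatment. $\Delta$ is the set of probability distributions $\sigma$ on $\mathcal W$ with $\sigma((k_1,\dots,k_n))=\sigma((\pi(k_1),\dots,\pi(k_n)))$ for every permutation $\pi$ of $\{1,\dots,m\}$. For $f:\mathcal X\to\mathbb R$, $B_{kl}(W,f)=\frac1p\sum_{i:W_i=k}f(X_i)-\frac1p\sum_{i:W_i=l}f(X_i)$, and $$D_{kk'}=\frac1m\sum_{l\ne k}B_{kl}(W,f_k)-\frac1m\sum_{l\ne k'}B_{k'l}(W,f_{k'}).$$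 $\mathcal F$ is a normed vector space of functions $\mathcal X\to\mathbb R$ with norm $\|\cdot\|$, extended by $\|f\|=\infty$ for $f\notin\mathcal F$. Since $B_{kl}(W,f)$ is invariant to adding constants to $f$, one always works modulo constant functions and $\|f\|$ means $\min_{c\in\mathbb R}\|f+c\|$. The resulting space is assumed to be a Banach space on which the evaluation differences $f\mapsto f(X_i)-f(X_j)$ are continuous. When the norm of $f_k$ or $f_{k'}$ is $\infty$, the bound is read as $+\infty$ (trivial). Given $X$: $M_{\mathrm P}^2(W)=\max_{\|f\|\le1}\max_{k\ne k'}B_{kk'}^2(W,f)$ for $W\in\mathcal W$; the pure strategy optimal design (PSOD) draws $W$ uniformly at random from $\arg\min_{W\in\mathcal W}M_{\mathrm P}^2(W)$, and $M_{\mathrm{P\text{-}opt}}^2$ is the (random, $X$-dependent) optimal value. $M_{\mathrm M}^2(\sigma)=\max_{\|f\|\le1}\max_{k\ne k'}\sum_{W\in\mathcal W}\sigma(W)B_{kk'}^2(W,f)$ for $\sigma\in\Delta$; the mixed strategy optimal design (MSOD) draws $W$ from some $\sigma\in\arg\min_{\sigma\in\Delta}M_{\mathrm M}^2(\sigma)$, and $M_{\mathrm{M\text{-}opt}}^2$ is the (random) optimal value. *)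

theory Defs
  imports "HOL-Probability.Probability"
begin

section \<open>Assignments and imbalance\<close>

text \<open>Subjects are \<open>1, \<dots>, m p\<close> and treatments are \<open>1, \<dots>, m\<close>. An element of
  \<open>{1, \<dots>, m}\<^sup>n\<close> is an extensional function, a covariate tuple is a function
  \<open>x\<close> of which only the values at the subjects matter.\<close>

definition all_assignments :: "nat \<Rightarrow> nat \<Rightarrow> (nat \<Rightarrow> nat) set" where
  "all_assignments m p = {1..m * p} \<rightarrow>\<^sub>E {1..m}"

definition balanced_assignments :: "nat \<Rightarrow> nat \<Rightarrow> (nat \<Rightarrow> nat) set" where
  "balanced_assignments m p =
     {w \<in> all_assignments m p. \<forall>k\<in>{1..m}. card {i \<in> {1..m * p}. w i = k} = p}"

definition symmetric_designs :: "nat \<Rightarrow> nat \<Rightarrow> (nat \<Rightarrow> nat) pmf set" where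
  "symmetric_designs m p =
     {\<sigma>. set_pmf \<sigma> \<subseteq> balanced_assignments m p \<and>
         (\<forall>\<pi>. \<pi> permutes {1..m} \<longrightarrow>
            (\<forall>w\<in>balanced_assignments m p. pmf \<sigma> w = pmf \<sigma> (\<lambda>i\<in>{1..m * p}. \<pi> (w i))))}"

definition imbalance ::
    "nat \<Rightarrow> nat \<Rightarrow> (nat \<Rightarrow> 'x) \<Rightarrow> (nat \<Rightarrow> nat) \<Rightarrow> ('x \<Rightarrow> real) \<Rightarrow> nat \<Rightarrow> nat \<Rightarrow> real" where
  "imbalance m p x w g k l =
     1 / real p * (\<Sum>i\<in>{i \<in> {1..m * p}. w i = k}. g (x i)) -
     1 / real p * (\<Sum>i\<in>{i \<in> {1..m * p}. w i = l}. g (x i))"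

definition imbalance_diff ::
    "nat \<Rightarrow> nat \<Rightarrow> (nat \<Rightarrow> 'x) \<Rightarrow> (nat \<Rightarrow> nat) \<Rightarrow> (nat \<Rightarrow> 'x \<Rightarrow> real) \<Rightarrow> nat \<Rightarrow> nat \<Rightarrow> real" where
  "imbalance_diff m p x w f k k' =
     1 / real m * (\<Sum>l\<in>{1..m} - {k}. imbalance m p x w (f k) k l) -
     1 / real m * (\<Sum>l\<in>{1..m} - {k'}. imbalance m p x w (f k') k' l)"

section \<open>Normed function spaces modulo constants\<close>

definition normed_function_space :: "('x \<Rightarrow> real) set \<Rightarrow> (('x \<Rightarrow> real) \<Rightarrow> real) \<Rightarrow> bool" where
  "normed_function_space F nrm \<longleftrightarrow>
     (\<lambda>x. 0) \<in> F \<and>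
     (\<forall>f\<in>F. \<forall>g\<in>F. (\<lambda>x. f x + g x) \<in> F) \<and>
     (\<forall>a. \<forall>f\<in>F. (\<lambda>x. a * f x) \<in> F) \<and>
     (\<forall>f\<in>F. 0 \<le> nrm f) \<and>
     (\<forall>f\<in>F. nrm f = 0 \<longleftrightarrow> f = (\<lambda>x. 0)) \<and>
     (\<forall>a. \<forall>f\<in>F. nrm (\<lambda>x. a * f x) = \<bar>a\<bar> * nrm f) \<and>
     (\<forall>f\<in>F. \<forall>g\<in>F. nrm (\<lambda>x. f x + g x) \<le> nrm f + nrm g)"

definition ext_norm :: "('x \<Rightarrow> real) set \<Rightarrow> (('x \<Rightarrow> real) \<Rightarrow> real) \<Rightarrow> ('x \<Rightarrow> real) \<Rightarrow> ennreal" where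
  "ext_norm F nrm f = (if f \<in> F then ennreal (nrm f) else \<infinity>)"

text \<open>In a normed function space the infimum below is a minimum: at most one shift of \<open>f\<close>
  lies in \<open>F\<close>, or else \<open>F\<close> contains the constants and the norm of \<open>f + c\<close> is continuous
  and coercive in \<open>c\<close>. The functions with finite \<open>mod_norm\<close> are those in \<open>F\<close> up to
  a constant; they represent the quotient space.\<close>

definition mod_norm :: "('x \<Rightarrow> real) set \<Rightarrow> (('x \<Rightarrow> real) \<Rightarrow> real) \<Rightarrow> ('x \<Rightarrow> real) \<Rightarrow> ennreal" where
  "mod_norm F nrm f = (INF c\<in>(UNIV::real set). ext_norm F nrm (\<lambda>x. f x + c))"

definition mod_complete :: "('x \<Rightarrow> real) set \<Rightarrow> (('x \<Rightarrow> real) \<Rightarrow> real) \<Rightarrow> bool" where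
  "mod_complete F nrm \<longleftrightarrow>
     (\<forall>g :: nat \<Rightarrow> 'x \<Rightarrow> real.
        (\<forall>j. mod_norm F nrm (g j) < \<infinity>) \<longrightarrow>
        (\<forall>e>0. \<exists>N. \<forall>i\<ge>N. \<forall>j\<ge>N. mod_norm F nrm (\<lambda>x. g i x - g j x) < e) \<longrightarrow>
        (\<exists>h. mod_norm F nrm h < \<infinity> \<and>
             (\<lambda>j. mod_norm F nrm (\<lambda>x. g j x - h x)) \<longlonglongrightarrow> 0))"

definition eval_diff_continuous ::
    "('x \<Rightarrow> real) set \<Rightarrow> (('x \<Rightarrow> real) \<Rightarrow> real) \<Rightarrow> 'x \<Rightarrow> 'x \<Rightarrow> bool" where
  "eval_diff_continuous F nrm a b \<longleftrightarrow>
     (\<forall>f. mod_norm F nrm f < \<infinity> \<longrightarrow>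
        (\<forall>e>0. \<exists>d>0. \<forall>g. mod_norm F nrm g < \<infinity> \<longrightarrow> mod_norm F nrm (\<lambda>x. g x - f x) < d \<longrightarrow>
           \<bar>(g a - g b) - (f a - f b)\<bar> < e))"

section \<open>Pure and mixed strategy optimal designs\<close>

definition pure_objective ::
    "nat \<Rightarrow> nat \<Rightarrow> ('x \<Rightarrow> real) set \<Rightarrow> (('x \<Rightarrow> real) \<Rightarrow> real) \<Rightarrow> (nat \<Rightarrow> 'x) \<Rightarrow> (nat \<Rightarrow> nat) \<Rightarrow> ennreal" where
  "pure_objective m p F nrm x w =
     (SUP g\<in>{g. mod_norm F nrm g \<le> 1}.
        SUP (k, k')\<in>{(k, k'). k \<in> {1..m} \<and> k' \<in> {1..m} \<and> k \<noteq> k'}.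
          ennreal ((imbalance m p x w g k k')\<^sup>2))"

definition pure_opt ::
    "nat \<Rightarrow> nat \<Rightarrow> ('x \<Rightarrow> real) set \<Rightarrow> (('x \<Rightarrow> real) \<Rightarrow> real) \<Rightarrow> (nat \<Rightarrow> 'x) \<Rightarrow> ennreal" where
  "pure_opt m p F nrm x = (INF w\<in>balanced_assignments m p. pure_objective m p F nrm x w)"

definition psod ::
    "nat \<Rightarrow> nat \<Rightarrow> ('x \<Rightarrow> real) set \<Rightarrow> (('x \<Rightarrow> real) \<Rightarrow> real) \<Rightarrow> (nat \<Rightarrow> 'x) \<Rightarrow> (nat \<Rightarrow> nat) pmf" where
  "psod m p F nrm x =
     pmf_of_set {w. is_arg_min (pure_objective m p F nrm x) (\<lambda>w. w \<in> balanced_assignments m p) w}"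

definition mixed_objective ::
    "nat \<Rightarrow> nat \<Rightarrow> ('x \<Rightarrow> real) set \<Rightarrow> (('x \<Rightarrow> real) \<Rightarrow> real) \<Rightarrow> (nat \<Rightarrow> 'x) \<Rightarrow> (nat \<Rightarrow> nat) pmf \<Rightarrow> ennreal" where
  "mixed_objective m p F nrm x \<sigma> =
     (SUP g\<in>{g. mod_norm F nrm g \<le> 1}.
        SUP (k, k')\<in>{(k, k'). k \<in> {1..m} \<and> k' \<in> {1..m} \<and> k \<noteq> k'}.
          ennreal (\<Sum>w\<in>balanced_assignments m p. pmf \<sigma> w * (imbalance m p x w g k k')\<^sup>2))"

definition mixed_opt ::
    "nat \<Rightarrow> nat \<Rightarrow> ('x \<Rightarrow> real) set \<Rightarrow> (('x \<Rightarrow> real) \<Rightarrow> real) \<Rightarrow> (nat \<Rightarrow> 'x) \<Rightarrow> ennreal" where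
  "mixed_opt m p F nrm x = (INF \<sigma>\<in>symmetric_designs m p. mixed_objective m p F nrm x \<sigma>)"

definition msods ::
    "nat \<Rightarrow> nat \<Rightarrow> ('x \<Rightarrow> real) set \<Rightarrow> (('x \<Rightarrow> real) \<Rightarrow> real) \<Rightarrow> (nat \<Rightarrow> 'x) \<Rightarrow> (nat \<Rightarrow> nat) pmf set" where
  "msods m p F nrm x =
     {\<sigma>. is_arg_min (mixed_objective m p F nrm x) (\<lambda>\<sigma>. \<sigma> \<in> symmetric_designs m p) \<sigma>}"

section \<open>Conditioning\<close>

definition tuple :: "'i set \<Rightarrow> ('i \<Rightarrow> 'a \<Rightarrow> 'b) \<Rightarrow> 'a \<Rightarrow> 'i \<Rightarrow> 'b" where
  "tuple I Z \<omega> = (\<lambda>i\<in>I. Z i \<omega>)"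

definition cond_indep ::
    "'a measure \<Rightarrow> 'a measure \<Rightarrow> 'b measure \<Rightarrow> ('a \<Rightarrow> 'b) \<Rightarrow> 'c measure \<Rightarrow> ('a \<Rightarrow> 'c) \<Rightarrow> bool" where
  "cond_indep M G N1 U N2 V \<longleftrightarrow>
     (\<forall>A\<in>sets N1. \<forall>B\<in>sets N2. AE \<omega> in M.
        real_cond_exp M G (\<lambda>\<omega>. indicator A (U \<omega>) * indicator B (V \<omega>)) \<omega> =
        real_cond_exp M G (\<lambda>\<omega>. indicator A (U \<omega>)) \<omega> * real_cond_exp M G (\<lambda>\<omega>. indicator B (V \<omega>)) \<omega>)"

text \<open>\<open>\<kappa> \<omega>\<close> is the conditional distribution, given \<open>G\<close>, of the random element \<open>W\<close>
  of the finite set \<open>A\<close>.\<close>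

definition drawn_from ::
    "'a measure \<Rightarrow> 'a measure \<Rightarrow> 'b set \<Rightarrow> ('a \<Rightarrow> 'b) \<Rightarrow> ('a \<Rightarrow> 'b pmf) \<Rightarrow> bool" where
  "drawn_from M G A W \<kappa> \<longleftrightarrow>
     (\<forall>w\<in>A. AE \<omega> in M. real_cond_exp M G (\<lambda>\<omega>. indicator {w} (W \<omega>)) \<omega> = pmf (\<kappa> \<omega>) w)"

text \<open>The arguments \<open>a\<close>, \<open>b\<close> are the norms of the two regression functions. The explicit
  case is needed because \<open>\<infinity> * 0 = 0\<close> on the extended nonnegative reals.\<close>

definition var_bound :: "nat \<Rightarrow> ennreal \<Rightarrow> ennreal \<Rightarrow> ennreal \<Rightarrow> ennreal" where
  "var_bound m a b E =
     (if a = \<infinity> \<or> b = \<infinity> then \<infinity> else (a + b)\<^sup>2 / 2 * ennreal (1 - 1 / real m) * E)"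

end

theory Submission
  imports Defs
begin

text \<open>The variance of \<open>D\<^sub>k\<^sub>k\<^sub>'\<close> is at most its second moment, and conditioning on the covariates
  turns that moment into the expectation of \<open>\<Sum>w. \<sigma> w * D(w)\<^sup>2\<close>, where \<open>\<sigma>\<close> is the design used at the
  observed covariates. So everything reduces to a bound on this finite sum for fixed covariates,
  and only the symmetry of \<open>\<sigma>\<close> under permuting treatments matters there: the minimizers of the
  pure objective form a set closed under relabelling treatments, hence the PSOD is symmetric like
  the MSOD.

  Put \<open>C\<^sub>k(g) = (1 / m) * (\<Sum>l \<noteq> k. B\<^sub>k\<^sub>l(g))\<close>. This is the mean of \<open>g\<close> over group \<open>k\<close> minus the
  average of all group means, so \<open>\<Sum>k. C\<^sub>k(g) = 0\<close>. Let \<open>A(g, h)\<close> be the mean of \<open>C\<^sub>k(g) C\<^sub>k(h)\<close> under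
  \<open>\<sigma>\<close>. By symmetry it does not depend on \<open>k\<close>, and neither does the mean of \<open>C\<^sub>k(g) C\<^sub>l(h)\<close> depend on
  \<open>l \<noteq> k\<close>; since the contrasts sum to zero, the latter equals \<open>- A(g, h) / (m - 1)\<close>. Two
  consequences follow. The mean of \<open>B\<^sub>k\<^sub>l(g)\<^sup>2 = (C\<^sub>k(g) - C\<^sub>l(g))\<^sup>2\<close> is \<open>2 m / (m - 1) * A(g, g)\<close>, so
  \<open>A(g, g) \<le> (1 - 1 / m) / 2 * \<parallel>g\<parallel>\<^sup>2 * M\<^sup>2\<close> by homogeneity, \<open>M\<^sup>2\<close> being the worst case over
  the unit ball (\<open>cross_moment_imbalance\<close>). And \<open>D\<^sub>k\<^sub>k\<^sub>' = C\<^sub>k(f\<^sub>k) - C\<^sub>k\<^sub>'(f\<^sub>k\<^sub>')\<close> has second moment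
  \<open>A(f\<^sub>k, f\<^sub>k) + A(f\<^sub>k\<^sub>', f\<^sub>k\<^sub>') + 2 / (m - 1) * A(f\<^sub>k, f\<^sub>k\<^sub>')\<close>, which by Cauchy-Schwarz and \<open>m \<ge> 2\<close> is at most
  the square of \<open>sqrt A(f\<^sub>k, f\<^sub>k) + sqrt A(f\<^sub>k\<^sub>', f\<^sub>k\<^sub>')\<close> (\<open>design_mean_imbalance_diff_le\<close>).

  Two points need care. If \<open>\<parallel>g\<parallel> = 0\<close> the claim must hold even when \<open>M\<^sup>2 = \<infinity>\<close>, and \<open>0 * \<infinity> = 0\<close>; this
  works because the norm modulo constants is attained, so that \<open>g\<close> is then constant
  (\<open>mod_norm_attained\<close>). And the optimal value may fail to be measurable in the covariates, so
  that its integral is a lower integral; a measurable function in between carries the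
  calculation, and the optimal value enters by monotonicity alone (\<open>nn_integral_drawn_le\<close>).\<close>

section \<open>Contrasts of group means\<close>

definition group_mean ::
    "nat \<Rightarrow> nat \<Rightarrow> (nat \<Rightarrow> 'x) \<Rightarrow> (nat \<Rightarrow> nat) \<Rightarrow> ('x \<Rightarrow> real) \<Rightarrow> nat \<Rightarrow> real" where
  "group_mean m p x w g k = 1 / real p * (\<Sum>i\<in>{i \<in> {1..m * p}. w i = k}. g (x i))"

text \<open>Subtracting the average of all group means leaves the differences between groups unchanged
  and makes the contrasts of the \<open>m\<close> groups sum to zero.\<close>

definition contrast ::
    "nat \<Rightarrow> nat \<Rightarrow> (nat \<Rightarrow> 'x) \<Rightarrow> (nat \<Rightarrow> nat) \<Rightarrow> ('x \<Rightarrow> real) \<Rightarrow> nat \<Rightarrow> real" where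
  "contrast m p x w g k = group_mean m p x w g k - (\<Sum>l\<in>{1..m}. group_mean m p x w g l) / real m"

lemma imbalance_group_mean:
  "imbalance m p x w g k l = group_mean m p x w g k - group_mean m p x w g l"
  by (simp add: imbalance_def group_mean_def)

lemma imbalance_contrast:
  "imbalance m p x w g k l = contrast m p x w g k - contrast m p x w g l"
  by (simp add: imbalance_group_mean contrast_def)

lemma mean_imbalance_eq_contrast:
  assumes "k \<in> {1..m}"
  shows "1 / real m * (\<Sum>l\<in>{1..m} - {k}. imbalance m p x w g k l) = contrast m p x w g k"
proof -
  have m: "real m > 0" using assms by auto
  have "(\<Sum>l\<in>{1..m} - {k}. imbalance m p x w g k l) = (\<Sum>l\<in>{1..m}. imbalance m p x w g k l)"
    using sum.remove[of "{1..m}" k "imbalance m p x w g k"] assms by (simp add: imbalance_def)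
  also have "\<dots> = real m * group_mean m p x w g k - (\<Sum>l\<in>{1..m}. group_mean m p x w g l)"
    by (simp add: imbalance_group_mean sum_subtractf)
  finally show ?thesis using m by (simp add: contrast_def field_simps)
qed

lemma imbalance_diff_contrast:
  assumes "k \<in> {1..m}" "k' \<in> {1..m}"
  shows "imbalance_diff m p x w f k k' = contrast m p x w (f k) k - contrast m p x w (f k') k'"
  unfolding imbalance_diff_def using assms by (simp only: mean_imbalance_eq_contrast)

lemma sum_contrast:
  assumes "0 < m"
  shows "(\<Sum>k\<in>{1..m}. contrast m p x w g k) = 0"
  using assms by (simp add: contrast_def sum_subtractf)

section \<open>Relabelling treatments\<close>

lemma finite_all_assignments: "finite (all_assignments m p)"
  by (simp add: all_assignments_def finite_PiE)

lemma balanced_subset: "balanced_assignments m p \<subseteq> all_assignments m p"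
  by (auto simp: balanced_assignments_def)

lemma finite_balanced: "finite (balanced_assignments m p)"
  using finite_all_assignments balanced_subset by (rule finite_subset[rotated])

definition relabel :: "nat \<Rightarrow> nat \<Rightarrow> (nat \<Rightarrow> nat) \<Rightarrow> (nat \<Rightarrow> nat) \<Rightarrow> nat \<Rightarrow> nat" where
  "relabel m p \<pi> w = (\<lambda>i\<in>{1..m * p}. \<pi> (w i))"

lemma relabel_eq_iff:
  assumes "\<pi> permutes {1..m}" and "i \<in> {1..m * p}"
  shows "relabel m p \<pi> w i = k \<longleftrightarrow> w i = inv \<pi> k"
  using assms(2) permutes_inv_eq[OF assms(1), of k "w i"] by (auto simp: relabel_def)

lemma group_mean_relabel:
  assumes "\<pi> permutes {1..m}"
  shows "group_mean m p x (relabel m p \<pi> w) g k = group_mean m p x w g (inv \<pi> k)"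
proof -
  have "{i \<in> {1..m * p}. relabel m p \<pi> w i = k} = {i \<in> {1..m * p}. w i = inv \<pi> k}"
    using relabel_eq_iff[OF assms] by blast
  then show ?thesis by (simp add: group_mean_def)
qed

lemma contrast_relabel:
  assumes "\<pi> permutes {1..m}"
  shows "contrast m p x (relabel m p \<pi> w) g k = contrast m p x w g (inv \<pi> k)"
proof -
  have "(\<Sum>l\<in>{1..m}. group_mean m p x w g (inv \<pi> l)) = (\<Sum>l\<in>{1..m}. group_mean m p x w g l)"
    using sum.permute[OF permutes_inv[OF assms], of "group_mean m p x w g"] by (simp add: o_def)
  then show ?thesis by (simp add: contrast_def group_mean_relabel[OF assms])
qed

lemma relabel_balanced:
  assumes "\<pi> permutes {1..m}" and w: "w \<in> balanced_assignments m p"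
  shows "relabel m p \<pi> w \<in> balanced_assignments m p"
proof -
  have pe: "w \<in> {1..m * p} \<rightarrow>\<^sub>E {1..m}"
    using w by (simp add: balanced_assignments_def all_assignments_def)
  have "relabel m p \<pi> w \<in> {1..m * p} \<rightarrow>\<^sub>E {1..m}"
    unfolding relabel_def
  proof (rule restrict_PiE_iff[THEN iffD2], rule ballI)
    fix i assume "i \<in> {1..m * p}"
    then have "w i \<in> {1..m}" using pe by blast
    then show "\<pi> (w i) \<in> {1..m}" using permutes_in_image[OF assms(1)] by blast
  qed
  moreover have "card {i \<in> {1..m * p}. relabel m p \<pi> w i = k} = p" if "k \<in> {1..m}" for k
  proof -
    have "inv \<pi> k \<in> {1..m}"
      using permutes_in_image[OF permutes_inv[OF assms(1)]] that by blast
    moreover have "{i \<in> {1..m * p}. relabel m p \<pi> w i = k} = {i \<in> {1..m * p}. w i = inv \<pi> k}"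
      using relabel_eq_iff[OF assms(1)] by blast
    ultimately show ?thesis using w by (simp add: balanced_assignments_def)
  qed
  ultimately show ?thesis by (simp add: balanced_assignments_def all_assignments_def)
qed

lemma relabel_inv:
  assumes "\<pi> permutes {1..m}" and w: "w \<in> balanced_assignments m p"
  shows "relabel m p (inv \<pi>) (relabel m p \<pi> w) = w"
    and "relabel m p \<pi> (relabel m p (inv \<pi>) w) = w"
proof -
  have "w \<in> extensional {1..m * p}"
    using w by (auto simp: balanced_assignments_def all_assignments_def PiE_def)
  then show "relabel m p (inv \<pi>) (relabel m p \<pi> w) = w"
    and "relabel m p \<pi> (relabel m p (inv \<pi>) w) = w"
    using permutes_inverses[OF assms(1)]
    by (auto simp: relabel_def fun_eq_iff extensional_def)
qed

lemma bij_betw_relabel: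
  assumes "\<pi> permutes {1..m}"
  shows "bij_betw (relabel m p \<pi>) (balanced_assignments m p) (balanced_assignments m p)"
  by (rule bij_betw_byWitness[where f' = "relabel m p (inv \<pi>)"])
     (use assms permutes_inv[OF assms] relabel_inv[OF assms] relabel_balanced in auto)

section \<open>Second moments under a symmetric design\<close>

definition design_mean :: "nat \<Rightarrow> nat \<Rightarrow> (nat \<Rightarrow> nat) pmf \<Rightarrow> ((nat \<Rightarrow> nat) \<Rightarrow> real) \<Rightarrow> real" where
  "design_mean m p \<sigma> h = (\<Sum>w\<in>balanced_assignments m p. pmf \<sigma> w * h w)"

lemma design_mean_relabel:
  assumes "\<sigma> \<in> symmetric_designs m p" and "\<pi> permutes {1..m}"
  shows "design_mean m p \<sigma> (\<lambda>w. h (relabel m p \<pi> w)) = design_mean m p \<sigma> h"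
proof -
  have "design_mean m p \<sigma> (\<lambda>w. h (relabel m p \<pi> w)) =
      (\<Sum>w\<in>balanced_assignments m p. pmf \<sigma> (relabel m p \<pi> w) * h (relabel m p \<pi> w))"
    unfolding design_mean_def using assms
    by (intro sum.cong refl) (auto simp: symmetric_designs_def relabel_def)
  also have "\<dots> = design_mean m p \<sigma> h"
    unfolding design_mean_def
    by (rule sum.reindex_bij_betw[OF bij_betw_relabel[OF assms(2)]])
  finally show ?thesis .
qed

definition cross_moment ::
    "nat \<Rightarrow> nat \<Rightarrow> (nat \<Rightarrow> 'x) \<Rightarrow> (nat \<Rightarrow> nat) pmf \<Rightarrow> ('x \<Rightarrow> real) \<Rightarrow> ('x \<Rightarrow> real) \<Rightarrow> nat \<Rightarrow> nat \<Rightarrow> real" where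
  "cross_moment m p x \<sigma> g h k l =
     design_mean m p \<sigma> (\<lambda>w. contrast m p x w g k * contrast m p x w h l)"

lemma cross_moment_permute:
  assumes "\<sigma> \<in> symmetric_designs m p" and "\<pi> permutes {1..m}"
  shows "cross_moment m p x \<sigma> g h (inv \<pi> k) (inv \<pi> l) = cross_moment m p x \<sigma> g h k l"
  using design_mean_relabel[OF assms, of "\<lambda>w. contrast m p x w g k * contrast m p x w h l"]
  by (simp add: cross_moment_def contrast_relabel[OF assms(2)])

lemma cross_moment_transpose:
  assumes "\<sigma> \<in> symmetric_designs m p" and "a \<in> {1..m}" "b \<in> {1..m}"
  shows "cross_moment m p x \<sigma> g h (Transposition.transpose a b k) (Transposition.transpose a b l) = cross_moment m p x \<sigma> g h k l"
  using cross_moment_permute[OF assms(1) permutes_swap_id[OF assms(2,3)]] by simp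

lemma cross_moment_diagonal:
  assumes "\<sigma> \<in> symmetric_designs m p" and "k \<in> {1..m}" "l \<in> {1..m}"
  shows "cross_moment m p x \<sigma> g h l l = cross_moment m p x \<sigma> g h k k"
  using cross_moment_transpose[OF assms, of x g h k k] by simp

text \<open>Fixing \<open>k\<close> and swapping \<open>l\<close> with any other index shows that all off-diagonal entries of row
  \<open>k\<close> agree; together with the diagonal entry they add up to zero, because the contrasts do.\<close>

lemma cross_moment_off_diagonal:
  assumes \<sigma>: "\<sigma> \<in> symmetric_designs m p" and k: "k \<in> {1..m}" and l: "l \<in> {1..m}" and "k \<noteq> l"
  shows "cross_moment m p x \<sigma> g h k l = - cross_moment m p x \<sigma> g h k k / real (m - 1)"
proof -
  have "0 < m" "m - 1 > 0" using k l \<open>k \<noteq> l\<close> by auto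
  have eq: "cross_moment m p x \<sigma> g h k j = cross_moment m p x \<sigma> g h k l" if "j \<in> {1..m} - {k}" for j
    using cross_moment_transpose[OF \<sigma>, of l j x g h k l] that l \<open>k \<noteq> l\<close> by (simp add: Transposition.transpose_def)
  have "0 = design_mean m p \<sigma> (\<lambda>w. contrast m p x w g k * (\<Sum>j\<in>{1..m}. contrast m p x w h j))"
    by (simp only: sum_contrast[OF \<open>0 < m\<close>]) (simp add: design_mean_def)
  also have "\<dots> = (\<Sum>j\<in>{1..m}. cross_moment m p x \<sigma> g h k j)"
    unfolding cross_moment_def design_mean_def sum_distrib_left by (rule sum.swap)
  also have "\<dots> = cross_moment m p x \<sigma> g h k k + (\<Sum>j\<in>{1..m} - {k}. cross_moment m p x \<sigma> g h k j)"
    using k by (intro sum.remove) auto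
  also have "(\<Sum>j\<in>{1..m} - {k}. cross_moment m p x \<sigma> g h k j) = real (m - 1) * cross_moment m p x \<sigma> g h k l"
    using eq k by simp
  finally show ?thesis using \<open>m - 1 > 0\<close> by (simp add: field_simps)
qed

lemma design_mean_square_diff:
  "design_mean m p \<sigma> (\<lambda>w. (contrast m p x w g k - contrast m p x w h l)\<^sup>2) =
     cross_moment m p x \<sigma> g g k k + cross_moment m p x \<sigma> h h l l - 2 * cross_moment m p x \<sigma> g h k l"
  unfolding cross_moment_def design_mean_def sum_distrib_left
    sum.distrib[symmetric] sum_subtractf[symmetric]
  by (intro sum.cong refl) (simp add: power2_eq_square algebra_simps)

text \<open>This ties the quantity that the designs control, the mean squared imbalance between two groups,
  to the diagonal moments that make up the variance.\<close>

lemma cross_moment_imbalance: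
  assumes \<sigma>: "\<sigma> \<in> symmetric_designs m p" and k: "k \<in> {1..m}" and l: "l \<in> {1..m}" and "k \<noteq> l"
  shows "cross_moment m p x \<sigma> g g k k =
     (1 - 1 / real m) / 2 * design_mean m p \<sigma> (\<lambda>w. (imbalance m p x w g k l)\<^sup>2)"
proof -
  have m: "real (m - 1) = real m - 1" "real m > 1" using k l \<open>k \<noteq> l\<close> by auto
  show ?thesis
    unfolding imbalance_contrast design_mean_square_diff
      cross_moment_off_diagonal[OF assms] cross_moment_diagonal[OF \<sigma> k l] m(1)
    using m(2) by (simp add: field_simps)
qed

text \<open>The probabilities are split as a product of square roots so that the unweighted inequality
  applies.\<close>

lemma cross_moment_Cauchy_Schwarz:
  "(cross_moment m p x \<sigma> g h k l)\<^sup>2 \<le> cross_moment m p x \<sigma> g g k k * cross_moment m p x \<sigma> h h l l"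
proof -
  let ?A = "\<lambda>w. sqrt (pmf \<sigma> w) * contrast m p x w g k"
  let ?B = "\<lambda>w. sqrt (pmf \<sigma> w) * contrast m p x w h l"
  let ?bal = "balanced_assignments m p"
  have s: "sqrt (pmf \<sigma> w) * a * (sqrt (pmf \<sigma> w) * b) = pmf \<sigma> w * (a * b)" for w a b
    using real_sqrt_mult_self[of "pmf \<sigma> w"] by (simp add: algebra_simps)
  have "(\<Sum>w\<in>?bal. ?A w * ?B w)\<^sup>2 \<le> (\<Sum>w\<in>?bal. (?A w)\<^sup>2) * (\<Sum>w\<in>?bal. (?B w)\<^sup>2)"
    by (rule Cauchy_Schwarz_ineq_sum)
  then show ?thesis
    unfolding power2_eq_square[of "?A _"] power2_eq_square[of "?B _"] s cross_moment_def design_mean_def .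
qed

text \<open>Since \<open>m \<ge> 2\<close>, the cross term \<open>2 / (m - 1) * A(f\<^sub>k, f\<^sub>k\<^sub>')\<close> is at most
  \<open>2 * sqrt (A(f\<^sub>k, f\<^sub>k) * A(f\<^sub>k\<^sub>', f\<^sub>k\<^sub>'))\<close>, which completes the square.\<close>

lemma design_mean_imbalance_diff_le:
  assumes \<sigma>: "\<sigma> \<in> symmetric_designs m p" and k: "k \<in> {1..m}" and k': "k' \<in> {1..m}" and "k \<noteq> k'"
    and "0 \<le> a" "0 \<le> b" "0 \<le> v"
    and a: "design_mean m p \<sigma> (\<lambda>w. (imbalance m p x w (f k) k k')\<^sup>2) \<le> a\<^sup>2 * v"
    and b: "design_mean m p \<sigma> (\<lambda>w. (imbalance m p x w (f k') k k')\<^sup>2) \<le> b\<^sup>2 * v"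
  shows "design_mean m p \<sigma> (\<lambda>w. (imbalance_diff m p x w f k k')\<^sup>2) \<le> (a + b)\<^sup>2 / 2 * (1 - 1 / real m) * v"
proof -
  let ?K = "\<lambda>g h. cross_moment m p x \<sigma> g h k k"
  define r where "r = (1 - 1 / real m) / 2"
  have m: "real (m - 1) \<ge> 1" "real m \<ge> 1" using k k' \<open>k \<noteq> k'\<close> by auto
  have r: "0 \<le> r" using m by (simp add: r_def)
  have Ka: "?K (f k) (f k) \<le> a\<^sup>2 * v * r"
    using mult_left_mono[OF a r]
    by (simp add: cross_moment_imbalance[OF \<sigma> k k' \<open>k \<noteq> k'\<close>] r_def mult_ac)
  have Kb: "?K (f k') (f k') \<le> b\<^sup>2 * v * r"
    using mult_left_mono[OF b r]
    by (simp add: cross_moment_imbalance[OF \<sigma> k k' \<open>k \<noteq> k'\<close>] r_def mult_ac)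
  have nn: "0 \<le> ?K g g" for g
    unfolding cross_moment_def design_mean_def by (intro sum_nonneg mult_nonneg_nonneg[OF pmf_nonneg zero_le_square])
  have "(?K (f k) (f k'))\<^sup>2 \<le> (a\<^sup>2 * v * r) * (b\<^sup>2 * v * r)"
    using cross_moment_Cauchy_Schwarz mult_mono[OF Ka Kb _ nn] r \<open>0 \<le> v\<close>
    by (meson mult_nonneg_nonneg order_trans zero_le_power2)
  also have "\<dots> = (a * b * v * r)\<^sup>2" by (simp add: power2_eq_square mult_ac)
  finally have Kab: "?K (f k) (f k') \<le> a * b * v * r"
    by (rule power2_le_imp_le) (use assms r in simp)
  have abr: "0 \<le> a * b * v * r" using assms r by simp
  have "?K (f k) (f k') / real (m - 1) \<le> a * b * v * r / real (m - 1)"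
    using Kab m by (intro divide_right_mono) auto
  also have "\<dots> \<le> a * b * v * r"
    using mult_left_mono[OF m(1) abr] m(1) by (simp add: divide_le_eq)
  finally have cross: "?K (f k) (f k') / real (m - 1) \<le> a * b * v * r" .
  have "design_mean m p \<sigma> (\<lambda>w. (imbalance_diff m p x w f k k')\<^sup>2) =
      ?K (f k) (f k) + ?K (f k') (f k') + 2 * (?K (f k) (f k') / real (m - 1))"
    unfolding imbalance_diff_contrast[OF k k'] design_mean_square_diff
      cross_moment_off_diagonal[OF \<sigma> k k' \<open>k \<noteq> k'\<close>] cross_moment_diagonal[OF \<sigma> k k'] by simp
  also have "\<dots> \<le> a\<^sup>2 * v * r + b\<^sup>2 * v * r + 2 * (a * b * v * r)"
    using cross by (intro add_mono Ka Kb) simp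
  also have "\<dots> = (a + b)\<^sup>2 / 2 * (1 - 1 / real m) * v"
  proof -
    have m_r: "1 - 1 / real m = 2 * r" by (simp add: r_def)
    show ?thesis unfolding m_r by (simp add: power2_eq_square algebra_simps)
  qed
  finally show ?thesis .
qed

section \<open>Norms modulo constants\<close>

lemma normed_function_spaceD:
  assumes "normed_function_space F nrm"
  shows normed_function_space_add: "\<And>f g. f \<in> F \<Longrightarrow> g \<in> F \<Longrightarrow> (\<lambda>x. f x + g x) \<in> F"
    and normed_function_space_scale: "\<And>a f. f \<in> F \<Longrightarrow> (\<lambda>x. a * f x) \<in> F"
    and normed_function_space_nonneg: "\<And>f. f \<in> F \<Longrightarrow> 0 \<le> nrm f"
    and normed_function_space_zero: "\<And>f. f \<in> F \<Longrightarrow> nrm f = 0 \<longleftrightarrow> f = (\<lambda>x. 0)"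
    and normed_function_space_homogeneous: "\<And>a f. f \<in> F \<Longrightarrow> nrm (\<lambda>x. a * f x) = \<bar>a\<bar> * nrm f"
    and normed_function_space_triangle:
      "\<And>f g. f \<in> F \<Longrightarrow> g \<in> F \<Longrightarrow> nrm (\<lambda>x. f x + g x) \<le> nrm f + nrm g"
proof -
  note * = assms[unfolded normed_function_space_def, THEN conjunct2]
  show "\<And>f g. f \<in> F \<Longrightarrow> g \<in> F \<Longrightarrow> (\<lambda>x. f x + g x) \<in> F"
    by (rule *[THEN conjunct1, rule_format])
  note * = *[THEN conjunct2]
  show "\<And>a f. f \<in> F \<Longrightarrow> (\<lambda>x. a * f x) \<in> F"
    by (rule *[THEN conjunct1, rule_format])
  note * = *[THEN conjunct2]
  show "\<And>f. f \<in> F \<Longrightarrow> 0 \<le> nrm f"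
    by (rule *[THEN conjunct1, rule_format])
  note * = *[THEN conjunct2]
  show "\<And>f. f \<in> F \<Longrightarrow> nrm f = 0 \<longleftrightarrow> f = (\<lambda>x. 0)"
    by (rule *[THEN conjunct1, rule_format])
  note * = *[THEN conjunct2]
  show "\<And>a f. f \<in> F \<Longrightarrow> nrm (\<lambda>x. a * f x) = \<bar>a\<bar> * nrm f"
    by (rule *[THEN conjunct1, rule_format])
  show "\<And>f g. f \<in> F \<Longrightarrow> g \<in> F \<Longrightarrow> nrm (\<lambda>x. f x + g x) \<le> nrm f + nrm g"
    by (rule *[THEN conjunct2, rule_format])
qed

text \<open>If only one shift of \<open>g\<close> lies in \<open>F\<close>, there is nothing to minimize. Otherwise the difference of
  two shifts shows that \<open>F\<close> contains the constants; then the norm of \<open>g + c\<close> is Lipschitz in \<open>c\<close>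
  and at least \<open>\<bar>c\<bar> \<parallel>1\<parallel> - \<parallel>g\<parallel>\<close>, so a minimum over a large compact interval is a global one.\<close>

lemma mod_norm_attained:
  assumes F: "normed_function_space F nrm" and fin: "mod_norm F nrm g < \<infinity>"
  obtains c where "(\<lambda>x. g x + c) \<in> F" and "mod_norm F nrm g = ennreal (nrm (\<lambda>x. g x + c))"
proof -
  note add = normed_function_space_add[OF F] and scale = normed_function_space_scale[OF F]
    and nn = normed_function_space_nonneg[OF F] and zero = normed_function_space_zero[OF F]
    and hom = normed_function_space_homogeneous[OF F] and tri = normed_function_space_triangle[OF F]
  obtain c0 where c0: "(\<lambda>x. g x + c0) \<in> F"
  proof -
    have "\<exists>c. ext_norm F nrm (\<lambda>x. g x + c) < \<infinity>"
      using fin unfolding mod_norm_def INF_less_iff by blast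
    then show ?thesis using that by (auto simp: ext_norm_def split: if_splits)
  qed
  define N where "N c = nrm (\<lambda>x. g x + c)" for c
  have min: "mod_norm F nrm g = ennreal (N c)"
    if "(\<lambda>x. g x + c) \<in> F" "\<And>d. (\<lambda>x. g x + d) \<in> F \<Longrightarrow> N c \<le> N d" for c
    unfolding mod_norm_def
  proof (rule antisym)
    show "(INF c. ext_norm F nrm (\<lambda>x. g x + c)) \<le> ennreal (N c)"
      by (rule INF_lower2[of c]) (use that in \<open>auto simp: ext_norm_def N_def\<close>)
    show "ennreal (N c) \<le> (INF c. ext_norm F nrm (\<lambda>x. g x + c))"
      by (rule INF_greatest) (use that in \<open>auto simp: ext_norm_def N_def intro!: ennreal_leI\<close>)
  qed
  show ?thesis
  proof (cases "\<exists>d. d \<noteq> c0 \<and> (\<lambda>x. g x + d) \<in> F")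
    case False
    then have "mod_norm F nrm g = ennreal (N c0)" by (intro min c0) auto
    then show ?thesis using that c0 by (simp add: N_def)
  next
    case True
    then obtain d where d: "d \<noteq> c0" "(\<lambda>x. g x + d) \<in> F" by blast
    have "(\<lambda>x. (1 / (d - c0)) * ((g x + d) + (-1) * (g x + c0))) \<in> F"
      by (intro scale add d c0)
    then have one: "(\<lambda>x. 1) \<in> F" using d by simp
    have const: "(\<lambda>x. a) \<in> F" "nrm (\<lambda>x. a) = \<bar>a\<bar> * nrm (\<lambda>x. 1)" for a
      using scale[OF one, of a] hom[OF one, of a] by simp_all
    have inF: "(\<lambda>x. g x + c) \<in> F" for c
      using add[OF c0 const(1)[of "c - c0"]] by simp
    have \<eta>: "nrm (\<lambda>x. 1) > 0"
      using nn[OF one] zero[OF one] by (auto simp: fun_eq_iff less_le)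
    have lip: "N c \<le> N e + \<bar>c - e\<bar> * nrm (\<lambda>x. 1)" for c e
      using tri[OF inF[of e] const(1)[of "c - e"]] const(2)[of "c - e"] by (simp add: N_def)
    have "(nrm (\<lambda>x. 1))-lipschitz_on UNIV N"
    proof (rule lipschitz_onI)
      fix c e show "dist (N c) (N e) \<le> nrm (\<lambda>x. 1) * dist c e"
        using lip[of c e] lip[of e c] by (simp add: dist_real_def abs_minus_commute mult.commute abs_le_iff)
    qed (use \<eta> in simp)
    then have cont: "continuous_on A N" for A
      using lipschitz_on_continuous_on continuous_on_subset by blast
    \<comment> \<open>Beyond this radius the lower bound on the norm exceeds its value at \<open>c = 0\<close>.\<close>
    define R where "R = 2 * N 0 / nrm (\<lambda>x. 1)"
    have N0: "N 0 \<ge> 0" using nn[OF inF[of 0]] by (simp add: N_def)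
    then have R: "0 \<le> R" using \<eta> by (simp add: R_def)
    obtain c where c: "c \<in> {-R..R}" and cmin: "\<And>e. e \<in> {-R..R} \<Longrightarrow> N c \<le> N e"
      using continuous_attains_inf[of "{-R..R}" N] cont R by auto
    have "N c \<le> N e" for e
    proof (cases "e \<in> {-R..R}")
      case False
      then have "R \<le> \<bar>e\<bar>" by auto
      then have "2 * N 0 \<le> \<bar>e\<bar> * nrm (\<lambda>x. 1)"
        using \<eta> by (simp add: R_def divide_le_eq)
      moreover have "\<bar>e\<bar> * nrm (\<lambda>x. 1) \<le> N e + N 0"
      proof -
        have "nrm (\<lambda>x. e) \<le> nrm (\<lambda>x. g x + e) + nrm (\<lambda>x. (-1) * (g x + 0))"
          using tri[OF inF[of e] scale[OF inF[of 0], of "-1"]] by simp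
        also have "nrm (\<lambda>x. (-1) * (g x + 0)) = N 0"
          using hom[OF inF[of 0], of "-1"] unfolding N_def by simp
        finally show ?thesis using const(2)[of e] by (simp add: N_def)
      qed
      moreover have "N c \<le> N 0" using cmin[of 0] R by simp
      ultimately show ?thesis by linarith
    qed (rule cmin)
    then have "mod_norm F nrm g = ennreal (N c)" by (intro min inF) auto
    then show ?thesis using that inF by (simp add: N_def)
  qed
qed

text \<open>Constants cancel because the groups of a balanced assignment have equal size.\<close>

lemma imbalance_affine:
  assumes w: "w \<in> balanced_assignments m p" and "k \<in> {1..m}" "l \<in> {1..m}"
  shows "imbalance m p x w (\<lambda>y. t * (g y + c)) k l = t * imbalance m p x w g k l"
proof -
  have "card {i \<in> {1..m * p}. w i = k} = p" "card {i \<in> {1..m * p}. w i = l} = p"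
    using assms by (auto simp: balanced_assignments_def)
  then show ?thesis
    by (simp add: imbalance_def sum.distrib sum_distrib_left[symmetric] distrib_left right_diff_distrib)
qed

text \<open>A nearest representative \<open>g + c\<close> modulo constants is either zero, and then \<open>g\<close> is constant and
  has no imbalance at all, or it can be normalized to lie in the unit ball.\<close>

lemma mean_square_imbalance_le:
  assumes F: "normed_function_space F nrm" and g: "mod_norm F nrm g < \<infinity>"
    and k: "k \<in> {1..m}" and l: "l \<in> {1..m}"
    and V: "\<And>h. mod_norm F nrm h \<le> 1 \<Longrightarrow>
      ennreal (design_mean m p \<sigma> (\<lambda>w. (imbalance m p x w h k l)\<^sup>2)) \<le> V"
  shows "ennreal (design_mean m p \<sigma> (\<lambda>w. (imbalance m p x w g k l)\<^sup>2)) \<le> (mod_norm F nrm g)\<^sup>2 * V"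
proof -
  obtain c where c: "(\<lambda>x. g x + c) \<in> F" and min: "mod_norm F nrm g = ennreal (nrm (\<lambda>x. g x + c))"
    using mod_norm_attained[OF F g] .
  define a where "a = nrm (\<lambda>x. g x + c)"
  have a: "0 \<le> a" and a0: "a = 0 \<Longrightarrow> (\<lambda>x. g x + c) = (\<lambda>x. 0)"
    and scaleF: "\<And>t. (\<lambda>x. t * (g x + c)) \<in> F" "\<And>t. nrm (\<lambda>x. t * (g x + c)) = \<bar>t\<bar> * a"
    unfolding a_def
    using normed_function_space_nonneg[OF F c] normed_function_space_zero[OF F c]
      normed_function_space_scale[OF F c] normed_function_space_homogeneous[OF F c] by blast+
  have scale: "design_mean m p \<sigma> (\<lambda>w. (imbalance m p x w (\<lambda>y. t * (g y + c)) k l)\<^sup>2) =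
      t\<^sup>2 * design_mean m p \<sigma> (\<lambda>w. (imbalance m p x w g k l)\<^sup>2)" for t
    unfolding design_mean_def sum_distrib_left
    by (intro sum.cong refl) (simp add: imbalance_affine[OF _ k l] power_mult_distrib mult_ac)
  show ?thesis
  proof (cases "a = 0")
    case True
    have "imbalance m p x w (\<lambda>y. 1 * (g y + c)) k l = 0" for w
      using a0[OF True] by (simp add: imbalance_def)
    then show ?thesis using scale[of 1] by (simp add: design_mean_def)
  next
    case False
    have "mod_norm F nrm (\<lambda>y. 1 / a * (g y + c)) \<le> ext_norm F nrm (\<lambda>y. 1 / a * (g y + c) + 0)"
      unfolding mod_norm_def by (rule INF_lower) simp
    also have "\<dots> = 1" using scaleF[of "1 / a"] a False by (simp add: ext_norm_def)
    finally have "ennreal ((1 / a)\<^sup>2 * design_mean m p \<sigma> (\<lambda>w. (imbalance m p x w g k l)\<^sup>2)) \<le> V"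
      using V scale[of "1 / a"] by metis
    then have "ennreal (a\<^sup>2) * ennreal ((1 / a)\<^sup>2 * design_mean m p \<sigma> (\<lambda>w. (imbalance m p x w g k l)\<^sup>2)) \<le>
        ennreal (a\<^sup>2) * V"
      by (rule mult_left_mono) simp
    also have "ennreal (a\<^sup>2) * ennreal ((1 / a)\<^sup>2 * design_mean m p \<sigma> (\<lambda>w. (imbalance m p x w g k l)\<^sup>2)) =
        ennreal (design_mean m p \<sigma> (\<lambda>w. (imbalance m p x w g k l)\<^sup>2))"
      using False by (subst ennreal_mult'[symmetric]) (auto simp: power_divide)
    also have "ennreal (a\<^sup>2) = (mod_norm F nrm g)\<^sup>2"
      using a by (simp add: min a_def ennreal_power)
    finally show ?thesis .
  qed
qed

text \<open>When \<open>V\<close> is infinite and some norm is positive the right-hand side is infinite; when both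
  norms vanish, both mean squared imbalances do, whatever \<open>V\<close> is. In the remaining case all
  quantities are finite.\<close>

lemma symmetric_design_bound:
  assumes F: "normed_function_space F nrm"
    and a: "mod_norm F nrm (f k) < \<infinity>" and b: "mod_norm F nrm (f k') < \<infinity>"
    and \<sigma>: "\<sigma> \<in> symmetric_designs m p" and k: "k \<in> {1..m}" and k': "k' \<in> {1..m}" and "k \<noteq> k'"
    and V: "\<And>h. mod_norm F nrm h \<le> 1 \<Longrightarrow>
      ennreal (design_mean m p \<sigma> (\<lambda>w. (imbalance m p x w h k k')\<^sup>2)) \<le> V"
  shows "ennreal (design_mean m p \<sigma> (\<lambda>w. (imbalance_diff m p x w f k k')\<^sup>2)) \<le>
    (mod_norm F nrm (f k) + mod_norm F nrm (f k'))\<^sup>2 / 2 * ennreal (1 - 1 / real m) * V"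
proof -
  have m: "0 < 1 - 1 / real m" using k k' \<open>k \<noteq> k'\<close> by (auto simp: field_simps)
  obtain s where s: "mod_norm F nrm (f k) = ennreal s" "0 \<le> s" using a by (cases "mod_norm F nrm (f k)") auto
  obtain t where t: "mod_norm F nrm (f k') = ennreal t" "0 \<le> t" using b by (cases "mod_norm F nrm (f k')") auto
  note le_s = mean_square_imbalance_le[OF F a k k' V, unfolded s(1)]
  note le_t = mean_square_imbalance_le[OF F b k k' V, unfolded t(1)]
  have c: "(ennreal s + ennreal t)\<^sup>2 / 2 * ennreal (1 - 1 / real m) = ennreal ((s + t)\<^sup>2 / 2 * (1 - 1 / real m))"
  proof -
    have "(ennreal s + ennreal t)\<^sup>2 / 2 = ennreal ((s + t)\<^sup>2 / 2)"
      using s t by (simp add: ennreal_plus[symmetric] ennreal_power ennreal_divide_numeral del: ennreal_plus)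
    then show ?thesis using m by (simp add: ennreal_mult'' del: times_divide_eq_left)
  qed
  show ?thesis
  proof (cases "V = \<infinity> \<and> s + t \<noteq> 0")
    case True
    then have "0 < (s + t)\<^sup>2 / 2 * (1 - 1 / real m)" using m by simp
    then have "ennreal ((s + t)\<^sup>2 / 2 * (1 - 1 / real m)) * V = \<infinity>"
      using True ennreal_mult_top by (simp only: infinity_ennreal_def ennreal_eq_0_iff not_le) simp
    then show ?thesis unfolding s t c by simp
  next
    case False
    \<comment> \<open>If \<open>V\<close> is infinite this is the default value 0, which is harmless as then \<open>s = t = 0\<close>.\<close>
    define v where "v = enn2real V"
    have "ennreal (s\<^sup>2) * V \<le> ennreal (s\<^sup>2 * v)" "ennreal (t\<^sup>2) * V \<le> ennreal (t\<^sup>2 * v)"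
      using False s t by (cases V; auto simp: v_def ennreal_mult' add_nonneg_eq_0_iff)+
    then have "ennreal (design_mean m p \<sigma> (\<lambda>w. (imbalance m p x w (f k) k k')\<^sup>2)) \<le> ennreal (s\<^sup>2 * v)"
        "ennreal (design_mean m p \<sigma> (\<lambda>w. (imbalance m p x w (f k') k k')\<^sup>2)) \<le> ennreal (t\<^sup>2 * v)"
      using order_trans[OF le_s] order_trans[OF le_t] s(2) t(2) by (simp_all add: ennreal_power)
    then have "design_mean m p \<sigma> (\<lambda>w. (imbalance m p x w (f k) k k')\<^sup>2) \<le> s\<^sup>2 * v"
        "design_mean m p \<sigma> (\<lambda>w. (imbalance m p x w (f k') k k')\<^sup>2) \<le> t\<^sup>2 * v"
      by (simp_all add: v_def)
    from design_mean_imbalance_diff_le[OF \<sigma> k k' \<open>k \<noteq> k'\<close> s(2) t(2) _ this]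
    have "design_mean m p \<sigma> (\<lambda>w. (imbalance_diff m p x w f k k')\<^sup>2) \<le> (s + t)\<^sup>2 / 2 * (1 - 1 / real m) * v"
      by (simp add: v_def)
    then have "ennreal (design_mean m p \<sigma> (\<lambda>w. (imbalance_diff m p x w f k k')\<^sup>2)) \<le>
        ennreal ((s + t)\<^sup>2 / 2 * (1 - 1 / real m) * v)" by (rule ennreal_leI)
    also have "\<dots> = ennreal ((s + t)\<^sup>2 / 2 * (1 - 1 / real m)) * ennreal v"
      by (rule ennreal_mult'') (simp add: v_def)
    also have "\<dots> \<le> ennreal ((s + t)\<^sup>2 / 2 * (1 - 1 / real m)) * V"
      by (rule mult_left_mono) (cases V; simp add: v_def)+
    finally show ?thesis unfolding s t c .
  qed
qed

section \<open>The optimal designs\<close>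

text \<open>The imbalances of a relabelled assignment are those of the original one at another pair of
  treatments, and the objective takes the maximum over all pairs.\<close>

lemma pure_objective_relabel_le:
  assumes "\<pi> permutes {1..m}"
  shows "pure_objective m p F nrm x (relabel m p \<pi> w) \<le> pure_objective m p F nrm x w"
  unfolding pure_objective_def
proof (rule SUP_mono[OF bexI], rule SUP_least)
  fix g :: "'a \<Rightarrow> real" and kl :: "nat \<times> nat"
  assume kl: "kl \<in> {(k, k'). k \<in> {1..m} \<and> k' \<in> {1..m} \<and> k \<noteq> k'}"
  obtain k l where [simp]: "kl = (k, l)" by fastforce
  have "(inv \<pi> k, inv \<pi> l) \<in> {(k, k'). k \<in> {1..m} \<and> k' \<in> {1..m} \<and> k \<noteq> k'}"
    using kl permutes_in_image[OF permutes_inv[OF assms]] permutes_inverses[OF assms]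
    by (auto simp del: atLeastAtMost_iff) metis
  moreover have "imbalance m p x (relabel m p \<pi> w) g k l = imbalance m p x w g (inv \<pi> k) (inv \<pi> l)"
    by (simp add: imbalance_contrast contrast_relabel[OF assms])
  ultimately show "(case kl of (k, k') \<Rightarrow> ennreal ((imbalance m p x (relabel m p \<pi> w) g k k')\<^sup>2)) \<le>
      (SUP (k, k')\<in>{(k, k'). k \<in> {1..m} \<and> k' \<in> {1..m} \<and> k \<noteq> k'}. ennreal ((imbalance m p x w g k k')\<^sup>2))"
    by (intro SUP_upper2[where i = "(inv \<pi> k, inv \<pi> l)"]) simp_all
qed

lemma pure_objective_relabel:
  assumes "\<pi> permutes {1..m}" and "w \<in> balanced_assignments m p"
  shows "pure_objective m p F nrm x (relabel m p \<pi> w) = pure_objective m p F nrm x w"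
  using pure_objective_relabel_le[OF assms(1), of p F nrm x w]
    pure_objective_relabel_le[OF permutes_inv[OF assms(1)], of p F nrm x "relabel m p \<pi> w"]
  by (simp add: relabel_inv[OF assms])

text \<open>Blocks of \<open>p\<close> consecutive subjects receive the same treatment.\<close>

lemma balanced_nonempty: "balanced_assignments m p \<noteq> {}"
proof -
  define w where "w = (\<lambda>i\<in>{1..m * p}. (i - 1) div p + 1)"
  have "w \<in> {1..m * p} \<rightarrow>\<^sub>E {1..m}"
    unfolding w_def
    by (auto simp: restrict_PiE_iff less_mult_imp_div_less Suc_le_eq)
  moreover have "card {i \<in> {1..m * p}. w i = k} = p" if k: "k \<in> {1..m}" for k
  proof (cases "p = 0")
    case False
    have block: "i div p = k - 1 \<longleftrightarrow> i \<in> {(k - 1) * p..<(k - 1) * p + p}" for i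
    proof -
      have "i div p = k - 1 \<longleftrightarrow> k - 1 \<le> i div p \<and> i div p < Suc (k - 1)" by linarith
      then show ?thesis
        using False by (simp add: less_eq_div_iff_mult_less_eq div_less_iff_less_mult add.commute)
    qed
    have le: "(k - 1) * p + p \<le> m * p"
      using k mult_le_mono1[of k m p] by (cases k) auto
    have "i \<in> {1..m * p} \<and> w i = k \<longleftrightarrow> i \<in> {(k - 1) * p + 1..(k - 1) * p + p}" for i
    proof (cases i)
      case (Suc j)
      have "w i = k \<longleftrightarrow> j div p = k - 1" if "i \<in> {1..m * p}"
        using that k Suc by (auto simp: w_def)
      then show ?thesis using block[of j] le Suc by auto
    qed simp
    then have "{i \<in> {1..m * p}. w i = k} = {(k - 1) * p + 1..(k - 1) * p + p}" by blast
    then show ?thesis by simp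
  qed (simp add: w_def)
  ultimately show ?thesis by (auto simp: balanced_assignments_def all_assignments_def)
qed

lemma psod_minimizers:
  "finite {w. is_arg_min (pure_objective m p F nrm x) (\<lambda>w. w \<in> balanced_assignments m p) w}"
  "{w. is_arg_min (pure_objective m p F nrm x) (\<lambda>w. w \<in> balanced_assignments m p) w} \<noteq> {}"
  using ex_is_arg_min_if_finite[OF finite_balanced balanced_nonempty, of "pure_objective m p F nrm x" m p]
    finite_subset[OF _ finite_balanced[of m p]]
  by (auto simp: is_arg_min_def)

lemma psod_symmetric: "psod m p F nrm x \<in> symmetric_designs m p"
proof -
  let ?A = "{w. is_arg_min (pure_objective m p F nrm x) (\<lambda>w. w \<in> balanced_assignments m p) w}"
  have "set_pmf (psod m p F nrm x) \<subseteq> balanced_assignments m p"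
    unfolding psod_def set_pmf_of_set[OF psod_minimizers(2,1)] by (auto simp: is_arg_min_def)
  moreover have "pmf (psod m p F nrm x) w = pmf (psod m p F nrm x) (relabel m p \<pi> w)"
    if "\<pi> permutes {1..m}" "w \<in> balanced_assignments m p" for \<pi> w
  proof -
    have "w \<in> ?A \<longleftrightarrow> relabel m p \<pi> w \<in> ?A"
      using that by (simp add: is_arg_min_def pure_objective_relabel relabel_balanced)
    then show ?thesis
      unfolding psod_def pmf_of_set[OF psod_minimizers(2,1)] by (simp add: indicator_def)
  qed
  ultimately show ?thesis by (simp add: symmetric_designs_def relabel_def)
qed

lemma sum_pmf_balanced:
  assumes "\<sigma> \<in> symmetric_designs m p"
  shows "(\<Sum>w\<in>balanced_assignments m p. pmf \<sigma> w) = 1"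
  using assms by (intro sum_pmf_eq_1 finite_balanced) (simp add: symmetric_designs_def)

text \<open>The bound holds for every single assignment in the support, hence for the mean.\<close>

lemma psod_mean_square_le:
  assumes h: "mod_norm F nrm h \<le> 1" and k: "k \<in> {1..m}" "k' \<in> {1..m}" "k \<noteq> k'"
  shows "ennreal (design_mean m p (psod m p F nrm x) (\<lambda>w. (imbalance m p x w h k k')\<^sup>2))
    \<le> pure_opt m p F nrm x"
proof -
  let ?\<sigma> = "psod m p F nrm x"
  have *: "ennreal (pmf ?\<sigma> w * (imbalance m p x w h k k')\<^sup>2) \<le> ennreal (pmf ?\<sigma> w) * pure_opt m p F nrm x"
    if w: "w \<in> balanced_assignments m p" for w
  proof (cases "w \<in> set_pmf ?\<sigma>")
    case True
    then have "is_arg_min (pure_objective m p F nrm x) (\<lambda>w. w \<in> balanced_assignments m p) w"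
      unfolding psod_def set_pmf_of_set[OF psod_minimizers(2,1)] by simp
    then have "pure_objective m p F nrm x w \<le> pure_opt m p F nrm x"
      unfolding pure_opt_def by (intro INF_greatest) (auto simp: is_arg_min_linorder)
    moreover have "ennreal ((imbalance m p x w h k k')\<^sup>2) \<le> pure_objective m p F nrm x w"
      unfolding pure_objective_def
      by (rule SUP_upper2[of h], use h in simp, rule SUP_upper2[of "(k, k')"]) (use k in auto)
    ultimately show ?thesis by (auto simp: ennreal_mult intro: mult_left_mono)
  next
    case False
    then show ?thesis by (simp add: set_pmf_iff)
  qed
  have "ennreal (design_mean m p ?\<sigma> (\<lambda>w. (imbalance m p x w h k k')\<^sup>2)) =
      (\<Sum>w\<in>balanced_assignments m p. ennreal (pmf ?\<sigma> w * (imbalance m p x w h k k')\<^sup>2))"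
    unfolding design_mean_def by (rule sum_ennreal[symmetric]) simp
  also have "\<dots> \<le> (\<Sum>w\<in>balanced_assignments m p. ennreal (pmf ?\<sigma> w) * pure_opt m p F nrm x)"
    by (rule sum_mono) (rule *)
  also have "\<dots> = pure_opt m p F nrm x"
    by (simp add: sum_distrib_right[symmetric] sum_pmf_balanced[OF psod_symmetric])
  finally show ?thesis .
qed

lemma msod_mean_square_le:
  assumes \<sigma>: "\<sigma> \<in> msods m p F nrm x"
    and h: "mod_norm F nrm h \<le> 1" and k: "k \<in> {1..m}" "k' \<in> {1..m}" "k \<noteq> k'"
  shows "ennreal (design_mean m p \<sigma> (\<lambda>w. (imbalance m p x w h k k')\<^sup>2)) \<le> mixed_opt m p F nrm x"
proof -
  have "ennreal (design_mean m p \<sigma> (\<lambda>w. (imbalance m p x w h k k')\<^sup>2)) \<le> mixed_objective m p F nrm x \<sigma>"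
    unfolding mixed_objective_def design_mean_def
    by (rule SUP_upper2[of h], use h in simp, rule SUP_upper2[of "(k, k')"]) (use k in auto)
  also have "\<dots> \<le> mixed_opt m p F nrm x"
    using \<sigma> unfolding mixed_opt_def msods_def by (intro INF_greatest) (auto simp: is_arg_min_linorder)
  finally show ?thesis .
qed

section \<open>Conditioning on the covariates\<close>

text \<open>If \<open>D\<close> is not square integrable, neither is \<open>D - expectation D\<close>, and the variance has the
  default value 0.\<close>

lemma (in prob_space) variance_le_nn_integral_square:
  assumes [measurable]: "D \<in> borel_measurable M"
  shows "ennreal (variance D) \<le> (\<integral>\<^sup>+ \<omega>. ennreal ((D \<omega>)\<^sup>2) \<partial>M)"
proof (cases "integrable M (\<lambda>\<omega>. (D \<omega>)\<^sup>2)")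
  case True
  then have "integrable M D" by (rule square_integrable_imp_integrable[rotated]) simp
  then have "variance D \<le> expectation (\<lambda>\<omega>. (D \<omega>)\<^sup>2)"
    using variance_eq[OF _ True] by simp
  then have "ennreal (variance D) \<le> ennreal (expectation (\<lambda>\<omega>. (D \<omega>)\<^sup>2))" by (rule ennreal_leI)
  also have "\<dots> = (\<integral>\<^sup>+ \<omega>. ennreal ((D \<omega>)\<^sup>2) \<partial>M)"
    by (rule nn_integral_eq_integral[symmetric]) (use True in auto)
  finally show ?thesis .
next
  case False
  have "\<not> integrable M (\<lambda>\<omega>. (D \<omega> - expectation D)\<^sup>2)"
  proof
    assume i: "integrable M (\<lambda>\<omega>. (D \<omega> - expectation D)\<^sup>2)"
    then have "integrable M (\<lambda>\<omega>. D \<omega> - expectation D)"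
      by (rule square_integrable_imp_integrable[rotated]) simp
    \<comment> \<open>Expand \<open>D\<^sup>2\<close> around the number \<open>expectation D\<close>.\<close>
    with i have "integrable M (\<lambda>\<omega>. (D \<omega> - expectation D)\<^sup>2 + 2 * expectation D * (D \<omega> - expectation D) + (expectation D)\<^sup>2)"
      by simp
    then have "integrable M (\<lambda>\<omega>. (D \<omega>)\<^sup>2)"
      by (rule back_subst[where P = "integrable M"]) (simp add: power2_eq_square algebra_simps fun_eq_iff)
    with False show False ..
  qed
  then show ?thesis by (simp add: not_integrable_integral_eq)
qed

text \<open>Real conditional expectations carry integrability side conditions when multiplied by unbounded
  functions; this translation into the nonnegative version avoids them.\<close>

lemma (in sigma_finite_subalgebra) nn_cond_exp_indicator_drawn:
  assumes A: "finite A" and W: "W \<in> measurable M (count_space A)" and "drawn_from M F A W \<kappa>" and w: "w \<in> A"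
  shows "AE \<omega> in M. nn_cond_exp M F (\<lambda>\<omega>. indicator {w} (W \<omega>)) \<omega> = ennreal (pmf (\<kappa> \<omega>) w)"
proof -
  have I: "(\<lambda>\<omega>. indicator {w} (W \<omega>) :: ennreal) \<in> borel_measurable M"
    by (rule measurable_compose[OF W]) simp
  have pos: "ennreal (indicator {w} (W \<omega>)) = indicator {w} (W \<omega>)"
    and neg: "ennreal (- indicator {w} (W \<omega>)) = 0" for \<omega>
    by (simp_all add: indicator_def ennreal_neg)
  have "AE \<omega> in M. nn_cond_exp M F (\<lambda>\<omega>. indicator {w} (W \<omega>)) \<omega> \<le> nn_cond_exp M F (\<lambda>\<omega>. 1) \<omega>"
    by (intro nn_cond_exp_mono AE_I2 I borel_measurable_const) (simp add: indicator_def)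
  moreover have "AE \<omega> in M. 1 = nn_cond_exp M F (\<lambda>\<omega>. 1) \<omega>" "AE \<omega> in M. 0 = nn_cond_exp M F (\<lambda>\<omega>. 0) \<omega>"
    by (rule nn_cond_exp_F_meas, simp)+
  moreover have "AE \<omega> in M. real_cond_exp M F (\<lambda>\<omega>. indicator {w} (W \<omega>)) \<omega> = pmf (\<kappa> \<omega>) w"
    using assms by (simp add: drawn_from_def)
  ultimately show ?thesis
  proof eventually_elim
    case (elim \<omega>)
    then have "enn2real (nn_cond_exp M F (\<lambda>\<omega>. indicator {w} (W \<omega>)) \<omega>) = pmf (\<kappa> \<omega>) w"
      by (simp add: real_cond_exp_def pos neg)
    moreover have "nn_cond_exp M F (\<lambda>\<omega>. indicator {w} (W \<omega>)) \<omega> < \<infinity>"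
      using elim by (metis ennreal_one_less_top infinity_ennreal_def order_le_less_trans)
    ultimately show ?case by (metis ennreal_enn2real infinity_ennreal_def)
  qed
qed

text \<open>Conditioning replaces the random assignment by its conditional distribution. The probabilities
  \<open>pmf (\<kappa> \<omega>) w\<close> and the bound \<open>u\<close> may fail to be measurable, and the lower integral is not
  additive on such functions. The proof therefore calculates with a measurable function \<open>h\<close>
  that agrees with the sum almost everywhere, and uses only monotonicity for \<open>u\<close>.\<close>

lemma (in sigma_finite_subalgebra) nn_integral_drawn_le:
  assumes A: "finite A" and W: "W \<in> measurable M (count_space A)" and \<kappa>: "drawn_from M F A W \<kappa>"
    and d: "\<And>w. w \<in> A \<Longrightarrow> d w \<in> borel_measurable F"
    and le: "AE \<omega> in M. (\<Sum>w\<in>A. ennreal (pmf (\<kappa> \<omega>) w) * d w \<omega>) \<le> C * u \<omega>" and C: "C < \<infinity>"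
  shows "(\<integral>\<^sup>+ \<omega>. d (W \<omega>) \<omega> \<partial>M) \<le> C * (\<integral>\<^sup>+ \<omega>. u \<omega> \<partial>M)"
proof -
  let ?I = "\<lambda>w \<omega>. indicator {w} (W \<omega>) :: ennreal"
  define h where "h \<omega> = (\<Sum>w\<in>A. d w \<omega> * nn_cond_exp M F (?I w) \<omega>)" for \<omega>
  have I [measurable]: "?I w \<in> borel_measurable M" if "w \<in> A" for w
    by (rule measurable_compose[OF W]) simp
  have dM [measurable]: "d w \<in> borel_measurable M" if "w \<in> A" for w
    by (rule measurable_from_subalg[OF subalg d[OF that]])
  have h [measurable]: "h \<in> borel_measurable M"
    unfolding h_def
    by (intro borel_measurable_sum borel_measurable_times_ennreal dM borel_measurable_nn_cond_exp2)
  have "(\<integral>\<^sup>+ \<omega>. d (W \<omega>) \<omega> \<partial>M) = (\<integral>\<^sup>+ \<omega>. (\<Sum>w\<in>A. d w \<omega> * ?I w \<omega>) \<partial>M)"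
  proof (rule nn_integral_cong)
    fix \<omega> assume "\<omega> \<in> space M"
    then have "W \<omega> \<in> A" using measurable_space[OF W] by simp
    then show "d (W \<omega>) \<omega> = (\<Sum>w\<in>A. d w \<omega> * ?I w \<omega>)"
      using A by (simp add: sum.remove[of A "W \<omega>"] indicator_def)
  qed
  also have "\<dots> = (\<Sum>w\<in>A. \<integral>\<^sup>+ \<omega>. d w \<omega> * ?I w \<omega> \<partial>M)"
    by (intro nn_integral_sum borel_measurable_times_ennreal dM I)
  also have "\<dots> = (\<Sum>w\<in>A. \<integral>\<^sup>+ \<omega>. d w \<omega> * nn_cond_exp M F (?I w) \<omega> \<partial>M)"
    by (intro sum.cong refl nn_cond_exp_intg[symmetric] d I)
  also have "\<dots> = (\<integral>\<^sup>+ \<omega>. h \<omega> \<partial>M)"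
    unfolding h_def
    by (intro nn_integral_sum[symmetric] borel_measurable_times_ennreal dM borel_measurable_nn_cond_exp2)
  finally have eq: "(\<integral>\<^sup>+ \<omega>. d (W \<omega>) \<omega> \<partial>M) = (\<integral>\<^sup>+ \<omega>. h \<omega> \<partial>M)" .
  have "AE \<omega> in M. \<forall>w\<in>A. nn_cond_exp M F (?I w) \<omega> = ennreal (pmf (\<kappa> \<omega>) w)"
    using A nn_cond_exp_indicator_drawn[OF A W \<kappa>] by (intro AE_finite_allI) auto
  with le have le: "AE \<omega> in M. h \<omega> \<le> C * u \<omega>"
    by eventually_elim (simp add: h_def mult.commute)
  have "(\<integral>\<^sup>+ \<omega>. h \<omega> \<partial>M) \<le> C * (\<integral>\<^sup>+ \<omega>. u \<omega> \<partial>M)"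
    \<comment> \<open>The factor \<open>C\<close> leaves the integral of the measurable \<open>h\<close>, not that of \<open>u\<close>.\<close>
  proof (cases "C = 0")
    case True
    then have "(\<integral>\<^sup>+ \<omega>. h \<omega> \<partial>M) \<le> (\<integral>\<^sup>+ \<omega>. 0 \<partial>M)"
      using le by (intro nn_integral_mono_AE) simp
    then show ?thesis by simp
  next
    case False
    have "C * t / C = t" for t
      using False C mult_divide_eq_ennreal[of C t] by (simp add: mult.commute)
    then have C_cancel: "C * t / C = t" "C * (t / C) = t" for t
      by (simp_all add: ennreal_times_divide)
    have "(\<integral>\<^sup>+ \<omega>. h \<omega> \<partial>M) = (\<integral>\<^sup>+ \<omega>. C * (h \<omega> / C) \<partial>M)"
      by (simp only: C_cancel)
    also have "\<dots> = C * (\<integral>\<^sup>+ \<omega>. h \<omega> / C \<partial>M)"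
      by (rule nn_integral_cmult) measurable
    also have "\<dots> \<le> C * (\<integral>\<^sup>+ \<omega>. u \<omega> \<partial>M)"
    proof (intro mult_left_mono nn_integral_mono_AE)
      show "AE \<omega> in M. h \<omega> / C \<le> u \<omega>"
        using le by eventually_elim (metis C_cancel(1) divide_right_mono_ennreal)
    qed simp
    finally show ?thesis .
  qed
  with eq show ?thesis by simp
qed

text \<open>Both designs are instances: \<open>\<kappa>\<close> is the design as a function of the outcome, and \<open>u\<close> is the
  optimal value, which dominates the mean squared imbalance of every function in the unit ball.\<close>

lemma variance_imbalance_diff_le:
  fixes X :: "nat \<Rightarrow> 'a \<Rightarrow> 'x" and \<kappa> :: "'a \<Rightarrow> (nat \<Rightarrow> nat) pmf" and u :: "'a \<Rightarrow> ennreal"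
  assumes M: "prob_space M"
    and X: "\<And>i. i \<in> {1..m * p} \<Longrightarrow> X i \<in> measurable M S"
    and f: "f k \<in> borel_measurable S" "f k' \<in> borel_measurable S"
    and G: "G = vimage_algebra (space M) (tuple {1..m * p} X) (\<Pi>\<^sub>M i\<in>{1..m * p}. S)"
    and W: "W \<in> measurable M (count_space (all_assignments m p))"
    and F: "normed_function_space F nrm"
    and drawn: "drawn_from M G (all_assignments m p) W \<kappa>"
    and k: "k \<in> {1..m}" "k' \<in> {1..m}" "k \<noteq> k'"
    and sym: "AE \<omega> in M. \<kappa> \<omega> \<in> symmetric_designs m p"
    and le: "AE \<omega> in M. \<forall>h. mod_norm F nrm h \<le> 1 \<longrightarrow>
      ennreal (design_mean m p (\<kappa> \<omega>) (\<lambda>w. (imbalance m p (tuple {1..m * p} X \<omega>) w h k k')\<^sup>2)) \<le> u \<omega>"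
  shows "ennreal (prob_space.variance M
      (\<lambda>\<omega>. imbalance_diff m p (tuple {1..m * p} X \<omega>) (W \<omega>) f k k'))
    \<le> var_bound m (mod_norm F nrm (f k)) (mod_norm F nrm (f k')) (\<integral>\<^sup>+ \<omega>. u \<omega> \<partial>M)"
proof (cases "mod_norm F nrm (f k) = \<infinity> \<or> mod_norm F nrm (f k') = \<infinity>")
  case True
  then show ?thesis by (simp add: var_bound_def)
next
  case False
  then have fin: "mod_norm F nrm (f k) < \<infinity>" "mod_norm F nrm (f k') < \<infinity>"
    by (auto simp: less_top)
  interpret prob_space M by (rule M)
  let ?X = "tuple {1..m * p} X"
  let ?D = "\<lambda>w \<omega>. imbalance_diff m p (?X \<omega>) w f k k'"
  have tuple: "?X \<in> measurable M (\<Pi>\<^sub>M i\<in>{1..m * p}. S)"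
    unfolding tuple_def by (intro measurable_restrict X)
  have sub: "subalgebra M G"
    using tuple unfolding G subalgebra_def by (simp add: measurable_iff_sets)
  interpret finite_measure_subalgebra M G
    by unfold_locales (rule sub)
  have "?X \<in> measurable G (\<Pi>\<^sub>M i\<in>{1..m * p}. S)"
    unfolding G using tuple by (intro measurable_vimage_algebra1) (auto dest: measurable_space)
  then have XG: "(\<lambda>\<omega>. ?X \<omega> i) \<in> measurable G S" if "i \<in> {1..m * p}" for i
    by (rule measurable_compose[OF _ measurable_component_singleton[OF that]])
  have B: "(\<lambda>\<omega>. imbalance m p (?X \<omega>) w g j l) \<in> borel_measurable G"
    if "g \<in> borel_measurable S" for w g j l
    unfolding imbalance_def
    by (intro borel_measurable_diff borel_measurable_times borel_measurable_const borel_measurable_sum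
        measurable_compose[OF XG that]) auto
  have DG: "?D w \<in> borel_measurable G" for w
    unfolding imbalance_diff_def
    by (intro borel_measurable_diff borel_measurable_times borel_measurable_const borel_measurable_sum B f)
  have D: "(\<lambda>\<omega>. ?D (W \<omega>) \<omega>) \<in> borel_measurable M"
    by (rule measurable_compose_countable'[OF measurable_from_subalg[OF sub DG] W])
      (rule countable_finite[OF finite_all_assignments])
  define C where "C = (mod_norm F nrm (f k) + mod_norm F nrm (f k'))\<^sup>2 / 2 * ennreal (1 - 1 / real m)"
  have "C < \<infinity>"
    using fin by (auto simp: C_def ennreal_mult_less_top ennreal_divide_eq_top_iff less_top[symmetric] power2_eq_square ennreal_mult_eq_top_iff)
  have "AE \<omega> in M. (\<Sum>w\<in>all_assignments m p. ennreal (pmf (\<kappa> \<omega>) w) * ennreal ((?D w \<omega>)\<^sup>2)) \<le> C * u \<omega>"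
    using sym le
  proof eventually_elim
    case (elim \<omega>)
    have "(\<Sum>w\<in>all_assignments m p. ennreal (pmf (\<kappa> \<omega>) w) * ennreal ((?D w \<omega>)\<^sup>2)) =
        (\<Sum>w\<in>balanced_assignments m p. ennreal (pmf (\<kappa> \<omega>) w) * ennreal ((?D w \<omega>)\<^sup>2))"
      using elim(1) by (intro sum.mono_neutral_right finite_all_assignments balanced_subset)
        (auto simp: symmetric_designs_def set_pmf_iff)
    also have "\<dots> = ennreal (design_mean m p (\<kappa> \<omega>) (\<lambda>w. (?D w \<omega>)\<^sup>2))"
      unfolding design_mean_def by (simp add: ennreal_mult'[symmetric])
    also have "\<dots> \<le> C * u \<omega>"
      unfolding C_def using elim by (intro symmetric_design_bound[OF F fin elim(1) k]) auto
    finally show ?case .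
  qed
  from nn_integral_drawn_le[OF finite_all_assignments W drawn _ this \<open>C < \<infinity>\<close>]
  have "(\<integral>\<^sup>+ \<omega>. ennreal ((?D (W \<omega>) \<omega>)\<^sup>2) \<partial>M) \<le> C * (\<integral>\<^sup>+ \<omega>. u \<omega> \<partial>M)"
    using DG by simp
  with variance_le_nn_integral_square[OF D] show ?thesis
    using False by (simp add: var_bound_def C_def)
qed

theorem theorem8:
  fixes M :: "'a measure" and S :: "'x measure"
    and m p :: nat
    and X :: "nat \<Rightarrow> 'a \<Rightarrow> 'x" and Y :: "nat \<Rightarrow> nat \<Rightarrow> 'a \<Rightarrow> real"
    and f :: "nat \<Rightarrow> 'x \<Rightarrow> real"
    and W :: "'a \<Rightarrow> nat \<Rightarrow> nat"
    and F :: "('x \<Rightarrow> real) set" and nrm :: "('x \<Rightarrow> real) \<Rightarrow> real"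
    and G :: "'a measure"
  assumes "prob_space M" and "space S = UNIV"
    and "2 \<le> m" and "1 \<le> p"
    and "prob_space.indep_vars M (\<lambda>i. S \<Otimes>\<^sub>M (\<Pi>\<^sub>M k\<in>{1..m}. borel))
           (\<lambda>i \<omega>. (X i \<omega>, tuple {1..m} (Y i) \<omega>)) {1..m * p}"
    and "\<forall>i\<in>{1..m * p}. \<forall>j\<in>{1..m * p}.
           distr M (S \<Otimes>\<^sub>M (\<Pi>\<^sub>M k\<in>{1..m}. borel)) (\<lambda>\<omega>. (X i \<omega>, tuple {1..m} (Y i) \<omega>)) =
           distr M (S \<Otimes>\<^sub>M (\<Pi>\<^sub>M k\<in>{1..m}. borel)) (\<lambda>\<omega>. (X j \<omega>, tuple {1..m} (Y j) \<omega>))"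
    and "\<forall>i\<in>{1..m * p}. \<forall>k\<in>{1..m}. integrable M (\<lambda>\<omega>. (Y i k \<omega>)\<^sup>2)"
    and "\<forall>k\<in>{1..m}. f k \<in> borel_measurable S"
    and "\<forall>i\<in>{1..m * p}. \<forall>k\<in>{1..m}. AE \<omega> in M.
           f k (X i \<omega>) = real_cond_exp M (vimage_algebra (space M) (X i) S) (Y i k) \<omega>"
    and "G = vimage_algebra (space M) (tuple {1..m * p} X) (\<Pi>\<^sub>M i\<in>{1..m * p}. S)"
    and "W \<in> measurable M (count_space (all_assignments m p))"
    and "cond_indep M G (count_space (all_assignments m p)) W
           (\<Pi>\<^sub>M ik\<in>{1..m * p} \<times> {1..m}. borel) (tuple ({1..m * p} \<times> {1..m}) (\<lambda>(i, k). Y i k))"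
    and "normed_function_space F nrm" and "mod_complete F nrm"
    and "AE \<omega> in M. \<forall>i\<in>{1..m * p}. \<forall>j\<in>{1..m * p}. eval_diff_continuous F nrm (X i \<omega>) (X j \<omega>)"
  shows "(drawn_from M G (all_assignments m p) W (\<lambda>\<omega>. psod m p F nrm (tuple {1..m * p} X \<omega>)) \<longrightarrow>
           (\<forall>k\<in>{1..m}. \<forall>k'\<in>{1..m}. k \<noteq> k' \<longrightarrow>
              ennreal (prob_space.variance M
                (\<lambda>\<omega>. imbalance_diff m p (tuple {1..m * p} X \<omega>) (W \<omega>) f k k'))
              \<le> var_bound m (mod_norm F nrm (f k)) (mod_norm F nrm (f k'))
                  (\<integral>\<^sup>+ \<omega>. pure_opt m p F nrm (tuple {1..m * p} X \<omega>) \<partial>M))) \<and>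
         (\<forall>\<sigma>. (AE \<omega> in M. \<sigma> (tuple {1..m * p} X \<omega>) \<in> msods m p F nrm (tuple {1..m * p} X \<omega>)) \<and>
             drawn_from M G (all_assignments m p) W (\<lambda>\<omega>. \<sigma> (tuple {1..m * p} X \<omega>)) \<longrightarrow>
           (\<forall>k\<in>{1..m}. \<forall>k'\<in>{1..m}. k \<noteq> k' \<longrightarrow>
              ennreal (prob_space.variance M
                (\<lambda>\<omega>. imbalance_diff m p (tuple {1..m * p} X \<omega>) (W \<omega>) f k k'))
              \<le> var_bound m (mod_norm F nrm (f k)) (mod_norm F nrm (f k'))
                  (\<integral>\<^sup>+ \<omega>. mixed_opt m p F nrm (tuple {1..m * p} X \<omega>) \<partial>M)))"
proof -
  interpret prob_space M by (rule assms(1))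
  have X: "X i \<in> measurable M S" if "i \<in> {1..m * p}" for i
  proof -
    have "(\<lambda>\<omega>. (X i \<omega>, tuple {1..m} (Y i) \<omega>)) \<in> measurable M (S \<Otimes>\<^sub>M (\<Pi>\<^sub>M k\<in>{1..m}. borel))"
      using assms(5) that by (auto simp: indep_vars_def2)
    from measurable_compose[OF this measurable_fst] show ?thesis by simp
  qed
  have f: "f k \<in> borel_measurable S" if "k \<in> {1..m}" for k
    using assms(8) that by blast
  note core = variance_imbalance_diff_le[OF assms(1) X f f assms(10,11,13)]
  show ?thesis
  proof (intro conjI impI allI ballI)
    fix k k'
    assume drawn: "drawn_from M G (all_assignments m p) W (\<lambda>\<omega>. psod m p F nrm (tuple {1..m * p} X \<omega>))"
      and k: "k \<in> {1..m}" "k' \<in> {1..m}" "k \<noteq> k'"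
    show "ennreal (variance (\<lambda>\<omega>. imbalance_diff m p (tuple {1..m * p} X \<omega>) (W \<omega>) f k k'))
      \<le> var_bound m (mod_norm F nrm (f k)) (mod_norm F nrm (f k'))
          (\<integral>\<^sup>+ \<omega>. pure_opt m p F nrm (tuple {1..m * p} X \<omega>) \<partial>M)"
      by (rule core[OF _ k(1,2) drawn k], assumption)
        (auto intro: psod_symmetric psod_mean_square_le[OF _ k])
  next
    fix \<sigma> k k'
    assume \<sigma>: "(AE \<omega> in M. \<sigma> (tuple {1..m * p} X \<omega>) \<in> msods m p F nrm (tuple {1..m * p} X \<omega>)) \<and>
        drawn_from M G (all_assignments m p) W (\<lambda>\<omega>. \<sigma> (tuple {1..m * p} X \<omega>))"
      and k: "k \<in> {1..m}" "k' \<in> {1..m}" "k \<noteq> k'"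
    have opt: "AE \<omega> in M. \<sigma> (tuple {1..m * p} X \<omega>) \<in> msods m p F nrm (tuple {1..m * p} X \<omega>)"
      using \<sigma> by blast
    show "ennreal (variance (\<lambda>\<omega>. imbalance_diff m p (tuple {1..m * p} X \<omega>) (W \<omega>) f k k'))
      \<le> var_bound m (mod_norm F nrm (f k)) (mod_norm F nrm (f k'))
          (\<integral>\<^sup>+ \<omega>. mixed_opt m p F nrm (tuple {1..m * p} X \<omega>) \<partial>M)"
    proof (rule core[OF _ k(1,2) conjunct2[OF \<sigma>] k])
      show "AE \<omega> in M. \<sigma> (tuple {1..m * p} X \<omega>) \<in> symmetric_designs m p"
        using opt by eventually_elim (simp add: msods_def is_arg_min_def)
    qed (assumption, use opt in \<open>eventually_elim, use msod_mean_square_le k in blast\<close>)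
  qed
qed

end
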